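(* Let $h:\mathbb{R}\to\mathbb{R}$ be of class $C^1$ (of class $C^2$ in item (i), where curvature is involved). The Lorentzian manifolds $\widetilde{\mathbb{M}}_h^{+}=(\widetilde{\mathcal H}_0,\widetilde g_h)$ and $\widetilde{\mathbb{M}}_h^{-}=(\widetilde{\mathcal H}_0,-\widetilde g_h)$, where $\widetilde{\mathcal H}_0=\{(x,\varPsi)\in\mathbb{R}\times\mathbb{R}_{>0} : \varPsi^2\neq -h(x)\}$ and $$\widetilde g_h=\frac{-\left(h(x)+\varPsi^2\right)^2dx^2+d\varPsi^2}{\varPsi^2},$$ have the following properties. (i) The sectional curvature of $\widetilde g_h$ is equal to $-1$. Thus $\widetilde{\mathbb{M}}_h^{+}$ is locally a two-dimensional anti-de Sitter space, while $\widetilde{\mathbb{M}}_h^{-}$ is locally a two-dimensional de Sitter space. (ii) $\widetilde{\mathbb{M}}_h^{+}$ and $\widetilde{\mathbb{M}}_h^{-}$ share all geodesic curves. (iii) Geodesic curves on $\widetilde{\mathbb{M}}_h^{+}$ and $\widetilde{\mathbb{M}}_h^{-}$ in explicit form $\Psi(x)$ obey $$\Psi''(x)=\frac{3\Psi^{2}(x)-h(x)}{\Psi^{2}(x)+h(x)}\,\frac{[\Psi'(x)]^{2}}{\Psi(x)}+\frac{h'(x)\Psi'(x)}{\Psi^{2}(x)+h(x)}-\frac{\Psi^{4}(x)-h^{2}(x)}{\Psi(x)}.$$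
   Context: Geodesic curves: affinely parametrized curves $s\mapsto (x(s),\varPsi(s))\in\widetilde{\mathcal H}_0$, $s$ real, solving $\ddot\varsigma^i+\Gamma^i_{jk}\dot\varsigma^j\dot\varsigma^k=0$ with the Levi-Civita connection of the metric, with initial conditions at $s=0$. Explicit form: if $\dot x(s)\neq 0$ for all $s\in\,]s_-,s_+[$ with $s_-<0<s_+$, one writes $\varPsi(s)=\Psi(x(s))$; the function $\Psi(x)$, defined on the interval $]x_-,x_+[$ which is the image of $]s_-,s_+[$ under $x(\cdot)$, is called the geodesic curve in explicit form. Curvature conventions: $R^i{}_{jkl}=\Gamma^i_{jl,k}-\Gamma^i_{jk,l}+\Gamma^i_{mk}\Gamma^m_{jl}-\Gamma^i_{ml}\Gamma^m_{jk}$, and the sectional curvature in dimension two is $K=R_{x\varPsi x\varPsi}/(g_{xx}g_{\varPsi\varPsi}-g_{x\varPsi}g_{\varPsi x})$. A two-dimensional Lorentzian manifold is "locally (anti-)de Sitter" when it is locally maximally symmetric, i.e. of constant nonzero sectional curvature; with these conventions, constant negative curvature (for $\widetilde g_h$) corresponds to anti-de Sitter and constant positive curvature (for $-\widetilde g_h$) to de Sitter. *)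

theory Defs
  imports "HOL-Analysis.Analysis"
begin

section \<open>Coordinate calculus on open subsets of Euclidean space\<close>

type_synonym 'n metric = "real^'n \<Rightarrow> real^'n^'n"

definition partial :: "'n \<Rightarrow> (real^'n \<Rightarrow> real) \<Rightarrow> real^'n \<Rightarrow> real" where
  "partial i f p = deriv (\<lambda>t. f (p + t *\<^sub>R axis i 1)) 0"

fun Ck_on :: "nat \<Rightarrow> (real^'n) set \<Rightarrow> (real^'n \<Rightarrow> real) \<Rightarrow> bool" where
  "Ck_on 0 U f \<longleftrightarrow> continuous_on U f"
| "Ck_on (Suc k) U f \<longleftrightarrow> (\<forall>p\<in>U. f differentiable (at p)) \<and> (\<forall>i. Ck_on k U (partial i f))"

definition christoffel :: "'n::finite metric \<Rightarrow> 'n \<Rightarrow> 'n \<Rightarrow> 'n \<Rightarrow> real^'n \<Rightarrow> real" where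
  "christoffel g i j k p =
     (1/2) * (\<Sum>l\<in>UNIV. matrix_inv (g p) $ i $ l *
        (partial j (\<lambda>q. g q $ l $ k) p + partial k (\<lambda>q. g q $ l $ j) p
          - partial l (\<lambda>q. g q $ j $ k) p))"

text \<open>\<open>riemann g i j k l\<close> is $R^i{}_{jkl}$, with the sign convention
  $R^i{}_{jkl} = \Gamma^i_{jl,k} - \Gamma^i_{jk,l} + \Gamma^i_{mk}\Gamma^m_{jl}
    - \Gamma^i_{ml}\Gamma^m_{jk}$.\<close>

definition riemann :: "'n::finite metric \<Rightarrow> 'n \<Rightarrow> 'n \<Rightarrow> 'n \<Rightarrow> 'n \<Rightarrow> real^'n \<Rightarrow> real" where
  "riemann g i j k l p =
     partial k (christoffel g i j l) p - partial l (christoffel g i j k) p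
     + (\<Sum>m\<in>UNIV. christoffel g i m k p * christoffel g m j l p)
     - (\<Sum>m\<in>UNIV. christoffel g i m l p * christoffel g m j k p)"

definition riemann_lower :: "'n::finite metric \<Rightarrow> 'n \<Rightarrow> 'n \<Rightarrow> 'n \<Rightarrow> 'n \<Rightarrow> real^'n \<Rightarrow> real" where
  "riemann_lower g i j k l p = (\<Sum>m\<in>UNIV. g p $ i $ m * riemann g m j k l p)"

text \<open>Geodesics are affinely parametrized, on an open interval containing the
  parameter value \<open>0\<close> at which initial conditions are posed.\<close>

definition geodesic :: "(real^'n::finite) set \<Rightarrow> 'n metric \<Rightarrow> real set \<Rightarrow> (real \<Rightarrow> real^'n) \<Rightarrow> bool" where
  "geodesic U g I c \<longleftrightarrow>
     open I \<and> is_interval I \<and> 0 \<in> I \<and> (\<forall>s\<in>I. c s \<in> U) \<and>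
     (\<exists>c' c''. \<forall>s\<in>I.
        (c has_vector_derivative c' s) (at s) \<and>
        (c' has_vector_derivative c'' s) (at s) \<and>
        (\<forall>i. c'' s $ i
           + (\<Sum>j\<in>UNIV. \<Sum>k\<in>UNIV. christoffel g i j k (c s) * c' s $ j * c' s $ k) = 0))"


section \<open>Lorentzian surfaces\<close>

text \<open>In coordinates, index \<open>1\<close> stands for \<open>x\<close> and index \<open>2\<close> for \<open>\<Psi>\<close>.
  The two vectors in the next definition are automatically a basis, orthogonal for
  the form \<open>g p\<close>; so the signature is \<open>(1,1)\<close>, and no choice between \<open>(-,+)\<close> and
  \<open>(+,-)\<close> is involved.\<close>

definition lorentzian_surface :: "nat \<Rightarrow> (real^2) set \<Rightarrow> 2 metric \<Rightarrow> bool" where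
  "lorentzian_surface k U g \<longleftrightarrow>
     open U \<and> (\<forall>i j. Ck_on k U (\<lambda>p. g p $ i $ j)) \<and>
     (\<forall>p\<in>U. transpose (g p) = g p \<and>
        (\<exists>v w. v \<bullet> (g p *v v) < 0 \<and> w \<bullet> (g p *v w) > 0 \<and> v \<bullet> (g p *v w) = 0))"

definition sectional_curvature :: "2 metric \<Rightarrow> real^2 \<Rightarrow> real" where
  "sectional_curvature g p =
     riemann_lower g 1 2 1 2 p / (g p $ 1 $ 1 * g p $ 2 $ 2 - g p $ 1 $ 2 * g p $ 2 $ 1)"

text \<open>Locally maximally symmetric means constant nonzero sectional curvature; its
  sign distinguishes the two cases.\<close>

definition locally_anti_de_sitter :: "(real^2) set \<Rightarrow> 2 metric \<Rightarrow> bool" where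
  "locally_anti_de_sitter U g \<longleftrightarrow>
     lorentzian_surface 2 U g \<and> (\<exists>K<0. \<forall>p\<in>U. sectional_curvature g p = K)"

definition locally_de_sitter :: "(real^2) set \<Rightarrow> 2 metric \<Rightarrow> bool" where
  "locally_de_sitter U g \<longleftrightarrow>
     lorentzian_surface 2 U g \<and> (\<exists>K>0. \<forall>p\<in>U. sectional_curvature g p = K)"

text \<open>\<open>S\<close> plays the role of $]s_-,s_+[$ and \<open>J\<close> of $]x_-,x_+[$.
  The values of \<open>\<Psi>\<close> outside \<open>J\<close> are irrelevant.\<close>

definition explicit_geodesic :: "(real^2) set \<Rightarrow> 2 metric \<Rightarrow> real set \<Rightarrow> (real \<Rightarrow> real) \<Rightarrow> bool" where
  "explicit_geodesic U g J \<Psi> \<longleftrightarrow>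
     (\<exists>I c S. geodesic U g I c \<and>
        S \<subseteq> I \<and> open S \<and> is_interval S \<and> 0 \<in> S \<and>
        (\<forall>s\<in>S. deriv (\<lambda>t. c t $ 1) s \<noteq> 0) \<and>
        J = (\<lambda>s. c s $ 1) ` S \<and>
        (\<forall>s\<in>S. c s $ 2 = \<Psi> (c s $ 1)))"

lemma explicit_geodesic_exists:
  assumes c: "geodesic U g I c"
    and S: "S \<subseteq> I" "open S" "is_interval S" "0 \<in> S"
    and nz: "\<forall>s\<in>S. deriv (\<lambda>t. c t $ 1) s \<noteq> 0"
  shows "\<exists>\<Psi>. explicit_geodesic U g ((\<lambda>s. c s $ 1) ` S) \<Psi> \<and> (\<forall>s\<in>S. c s $ 2 = \<Psi> (c s $ 1))"
proof -
  let ?x = "\<lambda>t. c t $ 1"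
  obtain c' where c': "\<And>s. s \<in> I \<Longrightarrow> (c has_vector_derivative c' s) (at s)"
    using c unfolding geodesic_def by metis
  have D: "(?x has_real_derivative c' s $ 1) (at s)" if "s \<in> I" for s
    using bounded_linear.has_vector_derivative[OF bounded_linear_vec_nth c'[OF that]]
    by (simp add: has_real_derivative_iff_has_vector_derivative)
  have no: "?x a \<noteq> ?x b" if ab: "a \<in> S" "b \<in> S" "a < b" for a b
  proof
    assume eq: "?x a = ?x b"
    have sub: "t \<in> S" if "a \<le> t" "t \<le> b" for t
      using S(3) ab that unfolding is_interval_1 by blast
    have "\<exists>z. a < z \<and> z < b \<and> ?x b - ?x a = (b - a) * c' z $ 1"
      using ab(3) sub S(1) D by (intro MVT2) blast+
    then obtain z where z: "a < z" "z < b" "c' z $ 1 = 0" using eq ab(3) by auto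
    have "z \<in> S" using sub z by simp
    then show False using nz z(3) DERIV_imp_deriv[OF D[of z]] S(1) by auto
  qed
  have inj: "inj_on ?x S"
    by (rule inj_onI) (metis no linorder_neqE_linordered_idom)
  define \<Psi> where "\<Psi> = (\<lambda>y. c (the_inv_into S ?x y) $ 2)"
  have "\<forall>s\<in>S. c s $ 2 = \<Psi> (c s $ 1)"
    unfolding \<Psi>_def using the_inv_into_f_f[OF inj] by simp
  then show ?thesis using assms unfolding explicit_geodesic_def by blast
qed


section \<open>The surfaces under consideration\<close>

definition H0 :: "(real \<Rightarrow> real) \<Rightarrow> (real^2) set" where
  "H0 h = {p. p $ 2 > 0 \<and> (p $ 2)\<^sup>2 \<noteq> - h (p $ 1)}"

definition gh :: "(real \<Rightarrow> real) \<Rightarrow> 2 metric" where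
  "gh h p = vector [vector [- (h (p $ 1) + (p $ 2)\<^sup>2)\<^sup>2 / (p $ 2)\<^sup>2, 0],
                    vector [0, 1 / (p $ 2)\<^sup>2]]"

end

theory Submission
  imports Defs
begin

text \<open>
  In the diagonal metric all Christoffel symbols are explicit; they are unchanged when the metric is
  multiplied by a nonzero constant \<open>c\<close>, so everything is computed for \<open>c *\<^sub>R gh h\<close> and then used with
  \<open>c = 1\<close> and \<open>c = - 1\<close>. The derivative of \<open>h\<close> occurs only in $\Gamma^1_{11}$, which does not enter
  $R^1{}_{212}$; the curvature is therefore a rational expression in \<open>\<Psi>\<close> and \<open>h\<close>. An explicit
  geodesic satisfies $\Psi' = \dot\Psi / \dot x$, and applying the same chain rule to $\Psi'$ turns the
  geodesic equations into the stated equation for $\Psi''$.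
\<close>

section \<open>Partial derivatives and the classes \<open>Ck_on\<close>\<close>

text \<open>Composing with the line \<open>p + t *\<^sub>R axis i 1\<close> and using linearity of
  \<open>f'\<close> reduces \<open>partial\<close> to a value of the Frechet derivative. The rules
  for constants, products, sums, compositions and coordinates below follow from this.\<close>

lemma has_derivative_imp_partial:
  assumes "(f has_derivative f') (at p)"
  shows "partial i f p = f' (axis i 1)"
proof -
  have line: "((\<lambda>t::real. p + t *\<^sub>R axis i 1) has_derivative (\<lambda>t. t *\<^sub>R axis i 1)) (at 0)"
    using has_derivative_add[OF has_derivative_const has_derivative_scaleR_left[OF has_derivative_ident]]
    by simp
  have "(f has_derivative f') (at (p + 0 *\<^sub>R axis i 1))"
    using assms by simp
  from has_derivative_compose[OF line this]
  have "((\<lambda>t. f (p + t *\<^sub>R axis i 1)) has_derivative (\<lambda>t. f' (t *\<^sub>R axis i 1))) (at 0)" .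
  moreover have "(\<lambda>t. f' (t *\<^sub>R axis i 1)) = (*) (f' (axis i 1))"
    by (rule ext) (simp only: linear_scale[OF has_derivative_linear[OF assms]] real_scaleR_def mult.commute)
  ultimately show ?thesis
    unfolding partial_def by (intro DERIV_imp_deriv) (simp only: has_field_derivative_def)
qed

text \<open>A small step along an axis stays in an open set, so only the germ at \<open>p\<close>
  matters. This permits differentiating formulas that hold only on \<open>H0 h\<close>, such as
  those for the Christoffel symbols.\<close>

lemma partial_cong:
  assumes "open U" "p \<in> U" "\<And>q. q \<in> U \<Longrightarrow> f q = g q"
  shows "partial i f p = partial i g p"
  unfolding partial_def
proof (rule deriv_cong_ev)
  have "((\<lambda>t::real. p + t *\<^sub>R axis i 1) \<longlongrightarrow> p + 0 *\<^sub>R axis i 1) (nhds 0)"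
    by (intro tendsto_intros filterlim_ident)
  then have "eventually (\<lambda>t::real. p + t *\<^sub>R axis i 1 \<in> U) (nhds 0)"
    using topological_tendstoD assms(1,2) by fastforce
  then show "\<forall>\<^sub>F t in nhds 0. f (p + t *\<^sub>R axis i 1) = g (p + t *\<^sub>R axis i 1)"
    by eventually_elim (use assms(3) in auto)
qed simp

lemma partial_const [simp]: "partial i (\<lambda>p. c) p = 0"
  using has_derivative_imp_partial[OF has_derivative_const] .

lemma partial_mult:
  assumes "f differentiable (at p)" "g differentiable (at p)"
  shows "partial i (\<lambda>q. f q * g q) p = f p * partial i g p + partial i f p * g p"
proof -
  obtain f' g' where "(f has_derivative f') (at p)" "(g has_derivative g') (at p)"
    using assms unfolding differentiable_def by blast
  then show ?thesis
    by (simp add: has_derivative_imp_partial[OF has_derivative_mult] has_derivative_imp_partial)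
qed

lemma partial_add:
  assumes "f differentiable (at p)" "g differentiable (at p)"
  shows "partial i (\<lambda>q. f q + g q) p = partial i f p + partial i g p"
proof -
  obtain f' g' where "(f has_derivative f') (at p)" "(g has_derivative g') (at p)"
    using assms unfolding differentiable_def by blast
  then show ?thesis
    by (simp add: has_derivative_imp_partial[OF has_derivative_add] has_derivative_imp_partial)
qed

lemma partial_compose:
  assumes "f differentiable (at p)" "(\<phi> has_real_derivative D) (at (f p))"
  shows "partial i (\<lambda>q. \<phi> (f q)) p = D * partial i f p"
proof -
  obtain f' where f': "(f has_derivative f') (at p)"
    using assms unfolding differentiable_def by blast
  have "((\<lambda>q. \<phi> (f q)) has_derivative (\<lambda>x. D * f' x)) (at p)"
    using has_derivative_compose[OF f', of \<phi> "(*) D"] assms(2)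
    by (simp add: has_field_derivative_def)
  then show ?thesis
    by (simp add: has_derivative_imp_partial[OF f'] has_derivative_imp_partial)
qed

lemma differentiable_compose_real:
  fixes \<phi> :: "real \<Rightarrow> real"
  assumes "f differentiable (at p)" "(\<phi> has_real_derivative D) (at (f p))"
  shows "(\<lambda>q. \<phi> (f q)) differentiable (at p)"
  using assms differentiable_compose[of \<phi> f p UNIV] real_differentiable_def by blast

lemma differentiable_nth: "(\<lambda>q::real^'n. q $ i) differentiable (at p)"
  by (rule bounded_linear_imp_differentiable) (rule bounded_linear_vec_nth)

lemma partial_nth: "partial i (\<lambda>q::real^'n::finite. q $ j) p = (if i = j then 1 else 0)"
  by (simp add: axis_def
      has_derivative_imp_partial[OF bounded_linear_imp_has_derivative[OF bounded_linear_vec_nth]])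

section \<open>Closure properties of the classes \<open>Ck_on\<close>\<close>

text \<open>Induction on the order, by \<open>partial_cong\<close>. The inductions below use it to
  replace \<open>partial i\<close> of a sum, product or inverse by the corresponding rule, which is
  available only on \<open>U\<close>.\<close>

lemma Ck_on_cong:
  assumes "open U" "Ck_on k U f" "\<And>p. p \<in> U \<Longrightarrow> f p = g p"
  shows "Ck_on k U g"
  using assms(2,3)
proof (induction k arbitrary: f g)
  case 0
  then show ?case by (simp cong: continuous_on_cong)
next
  case (Suc k)
  have "g differentiable (at p)" if "p \<in> U" for p
    using Suc.prems that assms(1) unfolding differentiable_def Ck_on.simps
    by (metis has_derivative_transform_within_open)
  moreover have "Ck_on k U (partial i g)" for i
    using Suc.prems Suc.IH[of "partial i f"] partial_cong[OF assms(1) _ Suc.prems(2)] by simp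
  ultimately show ?case by simp
qed

lemma Ck_on_SucD: "Ck_on (Suc k) U f \<Longrightarrow> Ck_on k U f"
proof (induction k arbitrary: f)
  case 0
  then show ?case
    by (simp add: continuous_at_imp_continuous_on differentiable_imp_continuous_within)
qed auto

lemma Ck_on_const [simp]:
  fixes U :: "(real^'n::finite) set"
  shows "Ck_on k U (\<lambda>p. c)"
proof (induction k arbitrary: c)
  case (Suc k)
  have "partial i (\<lambda>p. c) = (\<lambda>p::real^'n. 0)" for i :: 'n
    by (rule ext) simp
  then show ?case using Suc by simp
qed simp

lemma Ck_on_nth:
  fixes U :: "(real^'n::finite) set"
  shows "Ck_on k U (\<lambda>p. p $ j)"
proof (cases k)
  case (Suc m)
  have "partial i (\<lambda>p::real^'n. p $ j) = (\<lambda>p. if i = j then 1 else 0)" for i :: 'n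
    by (rule ext) (rule partial_nth)
  then show ?thesis using Suc by (simp add: differentiable_nth)
qed (auto intro: continuous_intros)

lemma Ck_on_add:
  assumes "open U" "Ck_on k U f" "Ck_on k U g"
  shows "Ck_on k U (\<lambda>p. f p + g p)"
  using assms(2,3)
proof (induction k arbitrary: f g)
  case (Suc k)
  have "Ck_on k U (partial i (\<lambda>p. f p + g p))" for i
    by (rule Ck_on_cong[OF assms(1) Suc.IH[of "partial i f" "partial i g"]])
      (use Suc.prems in \<open>auto simp: partial_add\<close>)
  then show ?case using Suc.prems by auto
qed (auto intro: continuous_intros)

text \<open>The Leibniz rule pairs first derivatives with the undifferentiated factors, and
  \<open>Ck_on_SucD\<close> lowers those factors to class \<open>k\<close> so that the induction
  hypothesis applies.\<close>

lemma Ck_on_mult: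
  assumes "open U" "Ck_on k U f" "Ck_on k U g"
  shows "Ck_on k U (\<lambda>p. f p * g p)"
  using assms(2,3)
proof (induction k arbitrary: f g)
  case (Suc k)
  note fg = Suc.prems[THEN Ck_on_SucD]
  have "Ck_on k U (partial i (\<lambda>p. f p * g p))" for i
    by (rule Ck_on_cong[OF assms(1) Ck_on_add[OF assms(1)
            Suc.IH[of f "partial i g"] Suc.IH[of "partial i f" g]]])
      (use Suc.prems fg in \<open>auto simp: partial_mult\<close>)
  then show ?case using Suc.prems by auto
qed (auto intro: continuous_intros)

lemma Ck_on_power:
  assumes "open U" "Ck_on k U f"
  shows "Ck_on k U (\<lambda>p. f p ^ n)"
  by (induction n) (auto intro: Ck_on_mult assms)

text \<open>The derivative \<open>- (inverse f)\<^sup>2 * partial i f\<close> involves the inverse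
  itself only in class \<open>k\<close>, which the induction hypothesis supplies.\<close>

lemma Ck_on_inverse:
  assumes "open U" "Ck_on k U f" "\<And>p. p \<in> U \<Longrightarrow> f p \<noteq> 0"
  shows "Ck_on k U (\<lambda>p. inverse (f p))"
  using assms(2)
proof (induction k)
  case 0
  then show ?case using assms(3) by (auto intro!: continuous_intros)
next
  case (Suc k)
  have inv: "(inverse has_real_derivative - (inverse (f p))\<^sup>2) (at (f p))" if "p \<in> U" for p
    using DERIV_inverse[OF assms(3)[OF that]] by (simp add: power2_eq_square)
  have "Ck_on k U (partial i (\<lambda>p. inverse (f p)))" for i
  proof (rule Ck_on_cong[OF assms(1)])
    show "Ck_on k U (\<lambda>p. (- 1) * (inverse (f p))\<^sup>2 * partial i f p)"
      using Suc.prems Suc.IH[OF Ck_on_SucD[OF Suc.prems]] assms(1)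
      by (intro Ck_on_mult Ck_on_power) auto
    show "- 1 * (inverse (f p))\<^sup>2 * partial i f p = partial i (\<lambda>p. inverse (f p)) p"
      if "p \<in> U" for p
      using partial_compose[where \<phi> = inverse and f = f, OF _ inv[OF that]] Suc.prems that by simp
  qed
  then show ?case
    using Suc.prems differentiable_compose_real[where \<phi> = inverse and f = f, OF _ inv] by auto
qed

text \<open>The partial derivative is \<open>\<phi>'\<close> times a Kronecker delta, so each
  application gains one order. Iteration transfers the regularity of \<open>h\<close> on the line to
  \<open>h (p $ 1)\<close> on the plane.\<close>

lemma Ck_on_compose_nth:
  fixes U :: "(real^'n::finite) set"
  assumes "open U" "\<And>x. (\<phi> has_real_derivative \<phi>' x) (at x)" "Ck_on k U (\<lambda>p. \<phi>' (p $ j))"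
  shows "Ck_on (Suc k) U (\<lambda>p. \<phi> (p $ j))"
proof -
  have "Ck_on k U (partial i (\<lambda>p. \<phi> (p $ j)))" for i
    by (rule Ck_on_cong[OF assms(1) Ck_on_mult[OF assms(1,3), of "\<lambda>p. if i = j then 1 else 0"]])
      (auto simp: partial_compose[OF differentiable_nth assms(2)] partial_nth)
  moreover have "(\<lambda>p::real^'n. \<phi> (p $ j)) differentiable (at p)" for p
    by (rule differentiable_compose_real[OF differentiable_nth assms(2)])
  ultimately show ?thesis by simp
qed

lemma C1_differentiable_imp_DERIV:
  fixes h :: "real \<Rightarrow> real"
  assumes "h C1_differentiable_on UNIV"
  shows "(h has_real_derivative deriv h x) (at x)" and "continuous_on UNIV (deriv h)"
proof -
  obtain D where D: "\<And>x. (h has_real_derivative D x) (at x)" "continuous_on UNIV D"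
    using assms unfolding C1_differentiable_on_def
    by (auto simp: has_real_derivative_iff_has_vector_derivative)
  then have "deriv h = D" using DERIV_imp_deriv by blast
  with D show "(h has_real_derivative deriv h x) (at x)" "continuous_on UNIV (deriv h)" by auto
qed

section \<open>The metrics \<open>c *\<^sub>R gh h\<close>\<close>

lemma gh_nth [simp]:
  "gh h p $ 1 $ 1 = - (h (p $ 1) + (p $ 2)\<^sup>2)\<^sup>2 / (p $ 2)\<^sup>2"
  "gh h p $ 1 $ 2 = 0" "gh h p $ 2 $ 1 = 0" "gh h p $ 2 $ 2 = 1 / (p $ 2)\<^sup>2"
  by (simp_all add: gh_def)

lemma H0_iff: "p \<in> H0 h \<longleftrightarrow> p $ 2 > 0 \<and> h (p $ 1) + (p $ 2)\<^sup>2 \<noteq> 0"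
  by (auto simp: H0_def)

lemma open_H0:
  assumes "continuous_on UNIV h"
  shows "open (H0 h)"
proof -
  have "continuous_on UNIV (\<lambda>p::real^2. h (p $ 1))"
    by (rule continuous_on_compose2[OF assms]) (auto intro: continuous_intros)
  then have "open {p::real^2. 0 < p $ 2}" "open {p::real^2. h (p $ 1) + (p $ 2)\<^sup>2 \<noteq> 0}"
    by (auto intro!: open_Collect_less open_Collect_neq continuous_intros)
  moreover have "H0 h = {p. 0 < p $ 2} \<inter> {p. h (p $ 1) + (p $ 2)\<^sup>2 \<noteq> 0}"
    by (auto simp: H0_iff)
  ultimately show ?thesis by auto
qed

text \<open>The coefficients are polynomials in \<open>h (p $ 1)\<close>, \<open>p $ 2\<close> and
  \<open>inverse (p $ 2)\<close>, hence of the class of \<open>h (p $ 1)\<close>. On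
  \<open>H0 h\<close> the diagonal entries have opposite signs, so the coordinate vectors, in an
  order depending on the sign of \<open>c\<close>, witness the signature.\<close>

lemma lorentzian_surface_gh:
  assumes "open (H0 h)" "Ck_on k (H0 h) (\<lambda>p. h (p $ 1))" "c \<noteq> 0"
  shows "lorentzian_surface k (H0 h) (\<lambda>p. c *\<^sub>R gh h p)"
proof -
  let ?U = "H0 h"
  have inv: "Ck_on k ?U (\<lambda>p. (inverse (p $ 2))\<^sup>2)"
    by (intro Ck_on_power Ck_on_inverse Ck_on_nth assms(1)) (auto simp: H0_iff)
  have "Ck_on k ?U (\<lambda>p. - c * (h (p $ 1) + (p $ 2)\<^sup>2)\<^sup>2 * (inverse (p $ 2))\<^sup>2)"
    by (intro Ck_on_mult Ck_on_power Ck_on_add Ck_on_nth Ck_on_const inv assms(1,2))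
  moreover have "Ck_on k ?U (\<lambda>p. c * (inverse (p $ 2))\<^sup>2)"
    by (intro Ck_on_mult Ck_on_const inv assms(1))
  ultimately have "Ck_on k ?U (\<lambda>p. (c *\<^sub>R gh h p) $ i $ j)" for i j
    using exhaust_2[of i] exhaust_2[of j]
    by (auto simp: divide_inverse power_inverse mult.assoc)
  moreover have "transpose (c *\<^sub>R gh h p) = c *\<^sub>R gh h p" for p
    by (simp add: vec_eq_iff transpose_def forall_2)
  moreover have "\<exists>v w. v \<bullet> ((c *\<^sub>R gh h p) *v v) < 0 \<and> w \<bullet> ((c *\<^sub>R gh h p) *v w) > 0
      \<and> v \<bullet> ((c *\<^sub>R gh h p) *v w) = 0" if "p \<in> ?U" for p
  proof -
    let ?B = "\<lambda>v w. v \<bullet> ((c *\<^sub>R gh h p) *v w)" and ?e = "\<lambda>i::2. axis i (1::real)"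
    have B: "?B (?e i) (?e j) = c * gh h p $ i $ j" for i j
      by (simp add: matrix_vector_mul_component inner_axis' inner_axis inner_commute)
    have "gh h p $ 1 $ 1 < 0" "gh h p $ 2 $ 2 > 0"
      using that by (auto simp: H0_iff)
    then have "c * gh h p $ 1 $ 1 < 0 \<and> 0 < c * gh h p $ 2 $ 2 \<or>
        c * gh h p $ 2 $ 2 < 0 \<and> 0 < c * gh h p $ 1 $ 1"
      using assms(3) by (cases "c > 0") (auto simp: mult_less_0_iff zero_less_mult_iff simp del: gh_nth)
    then show ?thesis
      unfolding B[symmetric]
    proof (elim disjE conjE)
      assume "?B (?e 1) (?e 1) < 0" "0 < ?B (?e 2) (?e 2)"
      moreover have "?B (?e 1) (?e 2) = 0" by (simp add: B)
      ultimately show ?thesis by blast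
    next
      assume "?B (?e 2) (?e 2) < 0" "0 < ?B (?e 1) (?e 1)"
      moreover have "?B (?e 2) (?e 1) = 0" by (simp add: B)
      ultimately show ?thesis by blast
    qed
  qed
  ultimately show ?thesis using assms(1) by (simp add: lorentzian_surface_def)
qed

section \<open>Christoffel symbols and curvature of the diagonal metric\<close>

text \<open>Since \<open>matrix_inv\<close> is chosen by \<open>SOME\<close>, exhibiting an inverse
  is not enough: associativity shows that the chosen two-sided inverse equals the diagonal
  candidate.\<close>

lemma matrix_inv_diagonal_2:
  fixes A :: "real^2^2"
  assumes "A $ 1 $ 2 = 0" "A $ 2 $ 1 = 0" "A $ 1 $ 1 \<noteq> 0" "A $ 2 $ 2 \<noteq> 0"
  shows "matrix_inv A = vector [vector [1 / A $ 1 $ 1, 0], vector [0, 1 / A $ 2 $ 2]]"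
    (is "_ = ?B")
proof -
  have AB: "A ** ?B = mat 1" "?B ** A = mat 1"
    using assms by (simp_all add: vec_eq_iff matrix_matrix_mult_def mat_def forall_2 sum_2)
  have "A ** matrix_inv A = mat 1 \<and> matrix_inv A ** A = mat 1"
    unfolding matrix_inv_def by (rule someI[where x = ?B]) (rule conjI[OF AB])
  then have "matrix_inv A = matrix_inv A ** (A ** ?B)" and "(matrix_inv A ** A) ** ?B = ?B"
    by (simp_all only: AB(1) matrix_mul_lid matrix_mul_rid)
  then show ?thesis by (simp only: matrix_mul_assoc)
qed

text \<open>Freezing the other coordinate leaves an ordinary one-variable derivative, within reach
  of \<open>derivative_eq_intros\<close>. The next lemma does the same for the second
  coordinate.\<close>

lemma partial_1_eqI:
  fixes F :: "real \<Rightarrow> real \<Rightarrow> real" and p :: "real^2"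
  assumes "((\<lambda>x. F x (p $ 2)) has_real_derivative D) (at (p $ 1))"
  shows "partial 1 (\<lambda>q. F (q $ 1) (q $ 2)) p = D"
  using assms DERIV_shift[of "\<lambda>x. F x (p $ 2)" D 0 "p $ 1"]
  unfolding partial_def by (intro DERIV_imp_deriv) (simp add: axis_def add.commute)

lemma partial_2_eqI:
  fixes F :: "real \<Rightarrow> real \<Rightarrow> real" and p :: "real^2"
  assumes "((\<lambda>y. F (p $ 1) y) has_real_derivative D) (at (p $ 2))"
  shows "partial 2 (\<lambda>q. F (q $ 1) (q $ 2)) p = D"
  using assms DERIV_shift[of "\<lambda>y. F (p $ 1) y" D 0 "p $ 2"]
  unfolding partial_def by (intro DERIV_imp_deriv) (simp add: axis_def add.commute)

text \<open>The first coefficient is \<open>- (h / y + y)\<^sup>2\<close> with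
  \<open>y = p $ 2\<close>; the factor \<open>h - y\<^sup>2\<close> in the second formula comes from
  the derivative \<open>1 - h / y\<^sup>2\<close> of \<open>h / y + y\<close>.\<close>

lemma partial_gh:
  assumes "p \<in> H0 h" "(h has_real_derivative D) (at (p $ 1))"
  defines "u \<equiv> h (p $ 1) + (p $ 2)\<^sup>2"
  shows "partial 1 (\<lambda>q. c * gh h q $ 1 $ 1) p = - c * 2 * u * D / (p $ 2)\<^sup>2"
    and "partial 2 (\<lambda>q. c * gh h q $ 1 $ 1) p = c * 2 * u * (h (p $ 1) - (p $ 2)\<^sup>2) / (p $ 2) ^ 3"
    and "partial 1 (\<lambda>q. c * gh h q $ 2 $ 2) p = 0"
    and "partial 2 (\<lambda>q. c * gh h q $ 2 $ 2) p = - c * 2 / (p $ 2) ^ 3"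
proof -
  have y: "p $ 2 \<noteq> 0" using assms(1) by (auto simp: H0_iff)
  show "partial 1 (\<lambda>q. c * gh h q $ 1 $ 1) p = - c * 2 * u * D / (p $ 2)\<^sup>2"
    unfolding gh_nth u_def
    by (rule partial_1_eqI[where F = "\<lambda>x y. c * (- (h x + y\<^sup>2)\<^sup>2 / y\<^sup>2)"])
      (use assms(2) y in \<open>auto intro!: derivative_eq_intros simp: field_simps eval_nat_numeral\<close>)
  show "partial 2 (\<lambda>q. c * gh h q $ 1 $ 1) p = c * 2 * u * (h (p $ 1) - (p $ 2)\<^sup>2) / (p $ 2) ^ 3"
    unfolding gh_nth u_def
    by (rule partial_2_eqI[where F = "\<lambda>x y. c * (- (h x + y\<^sup>2)\<^sup>2 / y\<^sup>2)"])
      (use y in \<open>auto intro!: derivative_eq_intros simp: field_simps eval_nat_numeral\<close>)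
  show "partial 1 (\<lambda>q. c * gh h q $ 2 $ 2) p = 0"
    unfolding gh_nth by (rule partial_1_eqI[where F = "\<lambda>x y. c * (1 / y\<^sup>2)"]) simp
  show "partial 2 (\<lambda>q. c * gh h q $ 2 $ 2) p = - c * 2 / (p $ 2) ^ 3"
    unfolding gh_nth
    by (rule partial_2_eqI[where F = "\<lambda>x y. c * (1 / y\<^sup>2)"])
      (use y in \<open>auto intro!: derivative_eq_intros simp: field_simps eval_nat_numeral\<close>)
qed

text \<open>The inverse metric carries the factor \<open>1 / c\<close> and the derivatives of the
  metric the factor \<open>c\<close>, so the scaling cancels.\<close>

lemma christoffel_gh:
  assumes "p \<in> H0 h" "(h has_real_derivative D) (at (p $ 1))" "c \<noteq> 0"
  defines "\<Gamma> \<equiv> \<lambda>i j k. christoffel (\<lambda>q. c *\<^sub>R gh h q) i j k p"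
  shows "\<Gamma> 1 1 1 = D / (h (p $ 1) + (p $ 2)\<^sup>2)"
    and "\<Gamma> 1 1 2 = ((p $ 2)\<^sup>2 - h (p $ 1)) / (p $ 2 * (h (p $ 1) + (p $ 2)\<^sup>2))"
    and "\<Gamma> 1 2 1 = ((p $ 2)\<^sup>2 - h (p $ 1)) / (p $ 2 * (h (p $ 1) + (p $ 2)\<^sup>2))"
    and "\<Gamma> 1 2 2 = 0"
    and "\<Gamma> 2 1 1 = ((p $ 2) ^ 4 - (h (p $ 1))\<^sup>2) / p $ 2"
    and "\<Gamma> 2 1 2 = 0"
    and "\<Gamma> 2 2 1 = 0"
    and "\<Gamma> 2 2 2 = - 1 / p $ 2"
proof -
  define y where "y = p $ 2"
  define u where "u = h (p $ 1) + y\<^sup>2"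
  have nz: "y \<noteq> 0" "u \<noteq> 0" using assms(1) by (auto simp: H0_iff y_def u_def)
  \<comment> \<open>Eliminating \<open>h\<close> in favour of \<open>u\<close> and \<open>y\<close>
    turns every denominator into a product of nonzero atoms, which \<open>field_simps\<close> can
    clear.\<close>
  have hu: "h (p $ 1) = u - y\<^sup>2" by (simp add: u_def)
  have inv: "matrix_inv (c *\<^sub>R gh h p) =
      vector [vector [- y\<^sup>2 / (c * u\<^sup>2), 0], vector [0, y\<^sup>2 / c]]"
    using nz assms(3) by (subst matrix_inv_diagonal_2) (simp_all add: y_def u_def)
  note P = partial_gh[OF assms(1,2), of c, folded y_def, folded u_def]
  have Z: "partial i (\<lambda>q. c * gh h q $ 1 $ 2) p = 0" "partial i (\<lambda>q. c * gh h q $ 2 $ 1) p = 0" for i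
    by simp_all
  show "\<Gamma> 1 1 1 = D / (h (p $ 1) + (p $ 2)\<^sup>2)"
    "\<Gamma> 1 1 2 = ((p $ 2)\<^sup>2 - h (p $ 1)) / (p $ 2 * (h (p $ 1) + (p $ 2)\<^sup>2))"
    "\<Gamma> 1 2 1 = ((p $ 2)\<^sup>2 - h (p $ 1)) / (p $ 2 * (h (p $ 1) + (p $ 2)\<^sup>2))"
    "\<Gamma> 1 2 2 = 0"
    "\<Gamma> 2 1 1 = ((p $ 2) ^ 4 - (h (p $ 1))\<^sup>2) / p $ 2"
    "\<Gamma> 2 1 2 = 0"
    "\<Gamma> 2 2 1 = 0"
    "\<Gamma> 2 2 2 = - 1 / p $ 2"
    unfolding \<Gamma>_def christoffel_def y_def[symmetric] u_def[symmetric]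
    using nz assms(3)
    \<comment> \<open>Without \<open>gh_nth\<close> the metric coefficients stay folded, so that the
      rules \<open>P\<close> and \<open>Z\<close> match.\<close>
    by (simp_all add: inv sum_2 P Z del: gh_nth)
      (simp_all add: hu field_simps power2_eq_square power3_eq_cube power4_eq_xxxx)
qed

text \<open>As the metric is diagonal, lowering the index multiplies R^1_{212} by the first diagonal
  entry, which cancels in the quotient. What remains is R^1_{212} = \<open>- 1 / y\<^sup>2\<close>
  divided by the second entry \<open>c / y\<^sup>2\<close>.\<close>

lemma sectional_curvature_gh:
  assumes "p \<in> H0 h" "\<And>x. (h has_real_derivative h' x) (at x)" "c \<noteq> 0"
  shows "sectional_curvature (\<lambda>q. c *\<^sub>R gh h q) p = - 1 / c"
proof -
  let ?G = "\<lambda>q. c *\<^sub>R gh h q"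
  have U: "open (H0 h)"
    by (rule open_H0[OF DERIV_continuous_on]) (rule assms(2))
  define y where "y = p $ 2"
  define u where "u = h (p $ 1) + y\<^sup>2"
  have nz: "y \<noteq> 0" "u \<noteq> 0" using assms(1) by (auto simp: H0_iff y_def u_def)
  have hu: "h (p $ 1) = u - y\<^sup>2" by (simp add: u_def)
  note Gam = christoffel_gh[OF _ assms(2,3)]
  have p1: "partial 1 (christoffel ?G 1 2 2) p = 0"
    by (subst partial_cong[OF U assms(1) Gam(4)]) simp_all
  \<comment> \<open>The closed form holds on all of the open set \<open>H0 h\<close>, so it may be
    differentiated; in the second coordinate \<open>h\<close> is constant.\<close>
  have "partial 2 (christoffel ?G 1 2 1) p =
    partial 2 (\<lambda>q. ((q $ 2)\<^sup>2 - h (q $ 1)) / (q $ 2 * (h (q $ 1) + (q $ 2)\<^sup>2))) p"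
    by (rule partial_cong[OF U assms(1) Gam(3)])
  also have "\<dots> = (2 * y * (y * u) - (y\<^sup>2 - h (p $ 1)) * (u + y * (2 * y))) / (y * u)\<^sup>2"
    unfolding y_def u_def
    by (rule partial_2_eqI[where F = "\<lambda>x y. (y\<^sup>2 - h x) / (y * (h x + y\<^sup>2))"])
      (use nz in \<open>auto intro!: derivative_eq_intros simp: y_def u_def power2_eq_square\<close>)
  finally have p2: "partial 2 (christoffel ?G 1 2 1) p = \<dots>" .
  have R: "riemann ?G 1 2 1 2 p = - 1 / y\<^sup>2"
    using nz unfolding riemann_def sum_2 p1 p2 Gam[OF assms(1)] y_def[symmetric] u_def[symmetric] hu
    by (simp add: field_simps power2_eq_square) 
  show ?thesis
    using nz assms(3)
    by (simp add: sectional_curvature_def riemann_lower_def sum_2 R y_def[symmetric] u_def[symmetric]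
        field_simps)
qed

section \<open>Geodesics\<close>

text \<open>The metric enters the geodesic equation only through its Christoffel symbols along the
  curve, which stays in \<open>U\<close>.\<close>

lemma geodesic_cong:
  assumes "\<And>p i j k. p \<in> U \<Longrightarrow> christoffel g i j k p = christoffel g' i j k p"
  shows "geodesic U g I c \<longleftrightarrow> geodesic U g' I c"
  using assms unfolding geodesic_def by (intro conj_cong refl ex_cong1 ball_cong) auto

text \<open>Since \<open>x'\<close> never vanishes, the mean value theorem makes \<open>x\<close>
  injective on the interval. Its inverse has derivative \<open>inverse (x' s)\<close>, and \<Psi> is
  \<open>y\<close> composed with that inverse on the image of \<open>x\<close>.\<close>

lemma parametric_derivative:
  fixes x y \<Psi> :: "real \<Rightarrow> real"
  assumes S: "open S" "is_interval S"
    and x: "\<And>s. s \<in> S \<Longrightarrow> (x has_real_derivative x' s) (at s)" "\<And>s. s \<in> S \<Longrightarrow> x' s \<noteq> 0"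
    and y: "\<And>s. s \<in> S \<Longrightarrow> (y has_real_derivative y' s) (at s)"
    and \<Psi>: "\<And>s. s \<in> S \<Longrightarrow> \<Psi> (x s) = y s"
    and s: "s \<in> S"
  shows "(\<Psi> has_real_derivative y' s / x' s) (at (x s))"
proof -
  have no: "x a \<noteq> x b" if ab: "a \<in> S" "b \<in> S" "a < b" for a b
  proof
    assume "x a = x b"
    have sub: "t \<in> S" if "a \<le> t" "t \<le> b" for t
      using S(2) ab that unfolding is_interval_1 by blast
    have "\<exists>z. a < z \<and> z < b \<and> x b - x a = (b - a) * x' z"
      using ab(3) sub x(1) by (intro MVT2) blast+
    then show False using \<open>x a = x b\<close> x(2) sub by force
  qed
  have inj: "inj_on x S"
    by (rule inj_onI) (metis no linorder_neqE_linordered_idom)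
  have cont: "continuous_on S x"
    by (rule DERIV_continuous_on[OF has_field_derivative_at_within[OF x(1)]])
  let ?g = "the_inv_into S x"
  have g: "?g (x t) = t" if "t \<in> S" for t
    by (rule the_inv_into_f_f[OF inj that])
  have "(?g has_real_derivative inverse (x' s)) (at (x s))"
    unfolding has_field_derivative_def
    by (rule has_derivative_inverse_strong[OF S(1) s cont g])
      (use x(1)[OF s] x(2)[OF s] in \<open>auto simp: has_field_derivative_def\<close>)
  moreover have "(y has_real_derivative y' s) (at (?g (x s)))"
    using y[OF s] by (simp only: g[OF s])
  ultimately have "((\<lambda>t. y (?g t)) has_real_derivative y' s * inverse (x' s)) (at (x s))"
    by (rule DERIV_chain2[rotated])
  then have "(\<Psi> has_real_derivative y' s * inverse (x' s)) (at (x s))"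
  proof (rule has_field_derivative_transform_within_open)
    \<comment> \<open>\<Psi> is known only on the image of \<open>x\<close>; openness makes
      agreement there sufficient to transfer the derivative.\<close>
    show "open (x ` S)" by (rule invariance_of_domain[OF cont S(1) inj])
    show "x s \<in> x ` S" using s by (rule imageI)
    show "y (?g t) = \<Psi> t" if "t \<in> x ` S" for t
      using that by (elim imageE) (simp only: g \<Psi>)
  qed
  then show ?thesis by (simp only: divide_inverse)
qed

text \<open>For velocity components X and Y the quotient rule gives \<Psi>'' = (Y' X - Y X') / X^3.
  After inserting the geodesic equations, X and Y survive only in Y / X = \<Psi>'. With u = h +
  \<Psi>^2, the coefficient of \<Psi>'^2 / \<Psi> is 1 + 2 (\<Psi>^2 - h) / u = (3 \<Psi>^2 - h) /
  u.\<close>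

lemma explicit_geodesic_gh:
  assumes h: "\<And>x. (h has_real_derivative h' x) (at x)" and "a \<noteq> 0"
    and expl: "explicit_geodesic (H0 h) (\<lambda>p. a *\<^sub>R gh h p) J \<Psi>"
    and "z \<in> J"
  shows "\<Psi> differentiable (at z)" and "deriv \<Psi> differentiable (at z)"
    and "deriv (deriv \<Psi>) z =
               (3 * (\<Psi> z)\<^sup>2 - h z) / ((\<Psi> z)\<^sup>2 + h z) * ((deriv \<Psi> z)\<^sup>2 / \<Psi> z)
               + h' z * deriv \<Psi> z / ((\<Psi> z)\<^sup>2 + h z)
               - ((\<Psi> z)^4 - (h z)\<^sup>2) / \<Psi> z"
proof -
  obtain I c S where geo: "geodesic (H0 h) (\<lambda>p. a *\<^sub>R gh h p) I c"
    and S: "S \<subseteq> I" "open S" "is_interval S"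
    and nz0: "\<forall>s\<in>S. deriv (\<lambda>t. c t $ 1) s \<noteq> 0"
    and J: "J = (\<lambda>s. c s $ 1) ` S"
    and graph0: "\<forall>s\<in>S. c s $ 2 = \<Psi> (c s $ 1)"
    using expl unfolding explicit_geodesic_def by (elim exE conjE) (rule that)
  have cU: "c s \<in> H0 h" if "s \<in> S" for s
    using geo S(1) that unfolding geodesic_def by blast
  have graph: "\<Psi> (c s $ 1) = c s $ 2" if "s \<in> S" for s
    using graph0 that by simp
  obtain c' c'' where ode: "\<forall>s\<in>I. (c has_vector_derivative c' s) (at s) \<and>
        (c' has_vector_derivative c'' s) (at s) \<and>
        (\<forall>i. c'' s $ i + (\<Sum>j\<in>UNIV. \<Sum>k\<in>UNIV.
           christoffel (\<lambda>p. a *\<^sub>R gh h p) i j k (c s) * c' s $ j * c' s $ k) = 0)"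
    using geo unfolding geodesic_def by (elim exE conjE) (rule that)
  have c': "(c has_vector_derivative c' s) (at s)" and c'': "(c' has_vector_derivative c'' s) (at s)"
    and eq: "c'' s $ i + (\<Sum>j\<in>UNIV. \<Sum>k\<in>UNIV.
        christoffel (\<lambda>p. a *\<^sub>R gh h p) i j k (c s) * c' s $ j * c' s $ k) = 0"
    if "s \<in> S" for s i
    using ode S(1) that by blast+
  have d: "((\<lambda>t. c t $ i) has_real_derivative c' s $ i) (at s)"
    and d': "((\<lambda>t. c' t $ i) has_real_derivative c'' s $ i) (at s)" if "s \<in> S" for s i
    unfolding has_real_derivative_iff_has_vector_derivative
    by (rule bounded_linear.has_vector_derivative[OF bounded_linear_vec_nth c'[OF that]],
        rule bounded_linear.has_vector_derivative[OF bounded_linear_vec_nth c''[OF that]])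
  have nz: "c' s $ 1 \<noteq> 0" if "s \<in> S" for s
    using bspec[OF nz0 that] unfolding DERIV_imp_deriv[OF d[OF that]] .
  have D1: "(\<Psi> has_real_derivative c' s $ 2 / c' s $ 1) (at (c s $ 1))" if "s \<in> S" for s
    by (rule parametric_derivative[OF S(2,3) d nz d graph that])
  then have dPsi: "deriv \<Psi> (c s $ 1) = c' s $ 2 / c' s $ 1" if "s \<in> S" for s
    using that DERIV_imp_deriv by blast
  have dq: "((\<lambda>t. c' t $ 2 / c' t $ 1) has_real_derivative
      (c'' s $ 2 * c' s $ 1 - c' s $ 2 * c'' s $ 1) / (c' s $ 1 * c' s $ 1)) (at s)" if "s \<in> S" for s
    using that nz by (intro DERIV_divide d')
  \<comment> \<open>The same rule, now with the velocity quotient as ordinate and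
    \<open>deriv \<Psi>\<close> as the function; \<open>dPsi\<close> is the graph condition on all
    of \<open>S\<close>.\<close>
  have D2: "(deriv \<Psi> has_real_derivative
      (c'' s $ 2 * c' s $ 1 - c' s $ 2 * c'' s $ 1) / (c' s $ 1 * c' s $ 1) / c' s $ 1) (at (c s $ 1))"
    if "s \<in> S" for s
    by (rule parametric_derivative[OF S(2,3) d nz dq dPsi that])
  obtain s where s: "s \<in> S" "z = c s $ 1" using \<open>z \<in> J\<close> J by auto
  show "\<Psi> differentiable (at z)" "deriv \<Psi> differentiable (at z)"
    using D1 D2 s real_differentiable_def by blast+
  define X Y y u where "X = c' s $ 1" and "Y = c' s $ 2" and "y = c s $ 2" and "u = h z + y\<^sup>2"
  have pos: "y \<noteq> 0" "u \<noteq> 0" "X \<noteq> 0"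
    using cU[OF s(1)] nz[OF s(1)] s(2) by (auto simp: H0_iff y_def u_def X_def)
  have hu: "h z = u - y\<^sup>2" by (simp add: u_def)
  note Gam = christoffel_gh[OF cU[OF s(1)] h \<open>a \<noteq> 0\<close>]
  \<comment> \<open>The factor 2 collects the two equal mixed symbols with upper index 1.\<close>
  have e1: "c'' s $ 1 = - (h' z / u * X * X + 2 * ((y\<^sup>2 - h z) / (y * u)) * X * Y)"
    using eq[OF s(1), of 1] unfolding sum_2 Gam s(2)[symmetric] X_def[symmetric] Y_def[symmetric]
      y_def[symmetric] u_def[symmetric] by (simp add: algebra_simps)
  have e2: "c'' s $ 2 = - ((y ^ 4 - (h z)\<^sup>2) / y * X * X) + Y * Y / y"
    using eq[OF s(1), of 2] unfolding sum_2 Gam s(2)[symmetric] X_def[symmetric] Y_def[symmetric]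
      y_def[symmetric] u_def[symmetric] by (simp add: algebra_simps)
  have "deriv (deriv \<Psi>) z = (c'' s $ 2 * X - Y * c'' s $ 1) / (X * X) / X"
    using DERIV_imp_deriv[OF D2[OF s(1)]] by (simp add: s(2) X_def Y_def)
  also have "\<dots> = (3 * y\<^sup>2 - h z) / u * ((Y / X)\<^sup>2 / y) + h' z * (Y / X) / u - (y ^ 4 - (h z)\<^sup>2) / y"
    unfolding e1 e2 hu using pos
    by (simp add: divide_simps) (simp add: algebra_simps power2_eq_square power4_eq_xxxx)
  finally show "deriv (deriv \<Psi>) z =
               (3 * (\<Psi> z)\<^sup>2 - h z) / ((\<Psi> z)\<^sup>2 + h z) * ((deriv \<Psi> z)\<^sup>2 / \<Psi> z)
               + h' z * deriv \<Psi> z / ((\<Psi> z)\<^sup>2 + h z)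
               - ((\<Psi> z)^4 - (h z)\<^sup>2) / \<Psi> z"
    using dPsi[OF s(1)] graph[OF s(1)] by (simp add: s(2) u_def X_def Y_def y_def add.commute)
qed

section \<open>The statement for both signs of the metric\<close>

theorem lemma1:
  fixes h :: "real \<Rightarrow> real"
  assumes C1: "h C1_differentiable_on UNIV"
  shows
    "lorentzian_surface 1 (H0 h) (gh h) \<and> lorentzian_surface 1 (H0 h) (\<lambda>p. - gh h p)
     \<and> (deriv h C1_differentiable_on UNIV \<longrightarrow>
          (\<forall>p\<in>H0 h. sectional_curvature (gh h) p = -1)
          \<and> locally_anti_de_sitter (H0 h) (gh h)
          \<and> locally_de_sitter (H0 h) (\<lambda>p. - gh h p))
     \<and> (\<forall>I c. geodesic (H0 h) (gh h) I c \<longleftrightarrow> geodesic (H0 h) (\<lambda>p. - gh h p) I c)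
     \<and> (\<forall>J \<Psi>. explicit_geodesic (H0 h) (gh h) J \<Psi>
               \<or> explicit_geodesic (H0 h) (\<lambda>p. - gh h p) J \<Psi> \<longrightarrow>
          (\<forall>x\<in>J. \<Psi> differentiable (at x) \<and> deriv \<Psi> differentiable (at x) \<and>
             deriv (deriv \<Psi>) x =
               (3 * (\<Psi> x)\<^sup>2 - h x) / ((\<Psi> x)\<^sup>2 + h x) * ((deriv \<Psi> x)\<^sup>2 / \<Psi> x)
               + deriv h x * deriv \<Psi> x / ((\<Psi> x)\<^sup>2 + h x)
               - ((\<Psi> x)^4 - (h x)\<^sup>2) / \<Psi> x))"
proof -
  note h = C1_differentiable_imp_DERIV[OF C1]
  have U: "open (H0 h)"
    by (rule open_H0[OF DERIV_continuous_on]) (rule h(1))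
  have C: "Ck_on 0 (H0 h) (\<lambda>p. f (p $ 1))" if "continuous_on UNIV f" for f
    by (auto intro!: continuous_on_compose2[OF that] continuous_intros)
  have lor1: "lorentzian_surface 1 (H0 h) (\<lambda>p. c *\<^sub>R gh h p)" if "c \<noteq> 0" for c
    using lorentzian_surface_gh[OF U Ck_on_compose_nth[OF U h(1) C[OF h(2)]] that] by simp
  have lor2: "lorentzian_surface 2 (H0 h) (\<lambda>p. c *\<^sub>R gh h p)"
    if "deriv h C1_differentiable_on UNIV" "c \<noteq> 0" for c
  proof -
    note h' = C1_differentiable_imp_DERIV[OF that(1)]
    \<comment> \<open>Two nested uses of \<open>Ck_on_compose_nth\<close>, for \<open>h\<close> and
      for \<open>deriv h\<close>, climb from continuity of \<open>deriv (deriv h)\<close> to class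
      2.\<close>
    show ?thesis
      using lorentzian_surface_gh[OF U
          Ck_on_compose_nth[OF U h(1) Ck_on_compose_nth[OF U h'(1) C[OF h'(2)]]] that(2)]
      by (simp add: numeral_2_eq_2)
  qed
  have curv: "sectional_curvature (\<lambda>p. c *\<^sub>R gh h p) p = - 1 / c" if "c \<noteq> 0" "p \<in> H0 h" for c p
    by (rule sectional_curvature_gh[OF that(2) h(1) that(1)])
  \<comment> \<open>After splitting the indices, both sides rewrite to the same closed form, in
    which the scaling factor no longer occurs.\<close>
  have chr: "christoffel (\<lambda>p. 1 *\<^sub>R gh h p) i j k p = christoffel (\<lambda>p. (- 1) *\<^sub>R gh h p) i j k p"
    if "p \<in> H0 h" for i j k p
    using exhaust_2[of i] exhaust_2[of j] exhaust_2[of k]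
    by (elim disjE) (simp_all only: christoffel_gh[OF that h(1)] one_neq_zero neg_equal_0_iff_equal
        not_False_eq_True)
  have one: "(\<lambda>p. 1 *\<^sub>R gh h p) = gh h" and neg: "(\<lambda>p. (- 1) *\<^sub>R gh h p) = (\<lambda>p. - gh h p)"
    by (simp_all add: fun_eq_iff)
  note pos_neg = lor1[of 1, unfolded one] lor1[of "- 1", unfolded neg]
  have curv_pos: "sectional_curvature (gh h) p = - 1"
    and curv_neg: "sectional_curvature (\<lambda>p. - gh h p) p = 1" if "p \<in> H0 h" for p
    using curv[of 1 p, unfolded one] curv[of "- 1" p, unfolded neg] that by simp_all
  have ads: "locally_anti_de_sitter (H0 h) (gh h)" if "deriv h C1_differentiable_on UNIV"
    unfolding locally_anti_de_sitter_def using lor2[OF that, of 1, unfolded one] curv_pos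
    by (intro conjI exI[of _ "- 1"]) simp_all
  have ds: "locally_de_sitter (H0 h) (\<lambda>p. - gh h p)" if "deriv h C1_differentiable_on UNIV"
    unfolding locally_de_sitter_def using lor2[OF that, of "- 1", unfolded neg] curv_neg
    by (intro conjI exI[of _ 1]) simp_all
  have geo: "geodesic (H0 h) (gh h) I c \<longleftrightarrow> geodesic (H0 h) (\<lambda>p. - gh h p) I c" for I c
    by (rule geodesic_cong[OF chr, unfolded one neg])
  note expl = explicit_geodesic_gh[where a = 1, OF h(1), unfolded one]
    explicit_geodesic_gh[where a = "- 1", OF h(1), unfolded neg]
  show ?thesis
  proof (intro conjI impI allI ballI)
    fix J \<Psi> x
    assume "explicit_geodesic (H0 h) (gh h) J \<Psi> \<or> explicit_geodesic (H0 h) (\<lambda>p. - gh h p) J \<Psi>"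
      and "x \<in> J"
    then show "\<Psi> differentiable (at x)" "deriv \<Psi> differentiable (at x)"
      "deriv (deriv \<Psi>) x =
               (3 * (\<Psi> x)\<^sup>2 - h x) / ((\<Psi> x)\<^sup>2 + h x) * ((deriv \<Psi> x)\<^sup>2 / \<Psi> x)
               + deriv h x * deriv \<Psi> x / ((\<Psi> x)\<^sup>2 + h x)
               - ((\<Psi> x)^4 - (h x)\<^sup>2) / \<Psi> x"
      by (elim disjE; intro expl; simp)+
  qed (use pos_neg curv_pos ads ds geo in simp_all)
qed

end
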